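(* Each of the following three permutation statistics is Mahonian: (1) $(a-cb)+(b-ac)+(c-ba)+(ba)$; (2) $(b-ac)+(b-ca)+(c-ba)+(ba)$; (3) $(a-cb)+(c-ab)+(c-ba)+(ba)$. That is, for each of them, every $n\ge1$ and every integer $k$, the number of $\pi\in\mathfrak S_n$ on which the statistic equals $k$ equals the number of $\pi\in\mathfrak S_n$ with $\mathrm{inv}\,\pi=k$.
   Context: $\mathfrak S_n$ is the set of permutations $\pi=\pi_1\cdots\pi_n$ of $\{1,\dots,n\}$; $\mathrm{inv}\,\pi=\#\{(i,j):1\le i<j\le n,\ \pi_i>\pi_j\}$. Vincular patterns are words over letters $a<b<c$ possibly containing dashes. An occurrence of a pattern $p=p_1\cdots p_k$ (letters, ignoring dashes) in $\pi$ is a sequence of positions $i_1<\dots<i_k$ such that $\pi_{i_1}\cdots\pi_{i_k}$ is order-isomorphic to $p_1\cdots p_k$, with $i_{r+1}=i_r+1$ whenever the $r$-th and $(r+1)$-st letters are not separated by a dash. $(\sigma+\tau+\cdots)\,\pi$ is the total number of occurrences of the listed patterns. E.g. $(c-ab)\,\pi=\#\{(i,j):i<j<n,\ \pi_j<\pi_{j+1}<\pi_i\}$ and $(ba)\,\pi=\#\{i<n:\pi_i>\pi_{i+1}\}$. *)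

theory Defs
  imports "HOL-Combinatorics.Permutations"
begin

text \<open>
  A permutation in \<open>\<SS>\<^sub>n\<close> is a function \<open>\<pi>\<close> with \<open>\<pi> permutes {1..n}\<close>; its word is
  \<open>\<pi> 1, \<dots>, \<pi> n\<close>.
\<close>

definition inversions :: "nat \<Rightarrow> (nat \<Rightarrow> nat) \<Rightarrow> nat" where
  "inversions n \<pi> = card {(i, j). 1 \<le> i \<and> i < j \<and> j \<le> n \<and> \<pi> i > \<pi> j}"

text \<open>
  A vincular pattern is the list of its maximal dash-free blocks, with the letters
  \<open>a < b < c\<close> written \<open>1 < 2 < 3\<close>: thus \<open>a-cb\<close> is \<open>[[1], [3, 2]]\<close> and \<open>ba\<close> is \<open>[[2, 1]]\<close>.
\<close>

type_synonym vincular = "nat list list"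

text \<open>
  \<open>dash_after p r\<close>: a dash follows the \<open>r\<close>-th letter of \<open>p\<close> (or \<open>r\<close> is \<open>0\<close> or the number of
  letters, which is irrelevant below).
\<close>

definition dash_after :: "vincular \<Rightarrow> nat \<Rightarrow> bool" where
  "dash_after p r \<longleftrightarrow> (\<exists>m\<le>length p. r = length (concat (take m p)))"

text \<open>
  The list \<open>is\<close> holds the positions \<open>i\<^sub>1 < \<dots> < i\<^sub>k\<close>, with \<open>is ! r\<close> being \<open>i\<^sub>r\<^sub>+\<^sub>1\<close>.
\<close>

definition occurrence :: "vincular \<Rightarrow> nat \<Rightarrow> (nat \<Rightarrow> nat) \<Rightarrow> nat list \<Rightarrow> bool" where
  "occurrence p n \<pi> is \<longleftrightarrow>
     length is = length (concat p) \<and> set is \<subseteq> {1..n} \<and> sorted_wrt (<) is \<and>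
     (\<forall>r<length is. \<forall>s<length is. \<pi> (is ! r) < \<pi> (is ! s) \<longleftrightarrow> concat p ! r < concat p ! s) \<and>
     (\<forall>r. Suc r < length is \<and> \<not> dash_after p (Suc r) \<longrightarrow> is ! Suc r = is ! r + 1)"

definition occ :: "vincular \<Rightarrow> nat \<Rightarrow> (nat \<Rightarrow> nat) \<Rightarrow> nat" where
  "occ p n \<pi> = card {is. occurrence p n \<pi> is}"

definition mahonian :: "(nat \<Rightarrow> (nat \<Rightarrow> nat) \<Rightarrow> nat) \<Rightarrow> bool" where
  "mahonian stat \<longleftrightarrow> (\<forall>n\<ge>1. \<forall>k::int.
     card {\<pi>. \<pi> permutes {1..n} \<and> int (stat n \<pi>) = k} =
     card {\<pi>. \<pi> permutes {1..n} \<and> int (inversions n \<pi>) = k})"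

text \<open>Two instances confirming the encoding.\<close>

lemma occ_c_ab:
  "occ [[3], [1, 2]] n \<pi> =
     card {(i, j). 1 \<le> i \<and> i < j \<and> j < n \<and> \<pi> j < \<pi> (j + 1) \<and> \<pi> (j + 1) < \<pi> i}"
proof -
  have d: "dash_after [[x], [y, z]] (Suc r) \<longleftrightarrow> r = 0 \<or> r = 2" for x y z r
    unfolding dash_after_def by (auto simp: le_Suc_eq ex_disj_distrib conj_disj_distribR)
  have "{is. occurrence [[3], [1, 2]] n \<pi> is} = (\<lambda>(i, j). [i, j, j + 1]) `
     {(i, j). 1 \<le> i \<and> i < j \<and> j < n \<and> \<pi> j < \<pi> (j + 1) \<and> \<pi> (j + 1) < \<pi> i}"
    (is "?L = ?R")
  proof (intro set_eqI iffI)
    fix "is" assume "is \<in> ?L"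
    then have o: "occurrence [[3], [1, 2]] n \<pi> is" by simp
    then obtain i j l where e: "is = [i, j, l]"
      by (auto simp: occurrence_def length_Suc_conv)
    have iso: "\<forall>r<3. \<forall>s<3. \<pi> (is ! r) < \<pi> (is ! s) \<longleftrightarrow> [3, 1, 2::nat] ! r < [3, 1, 2] ! s"
      and adj: "\<forall>r. Suc r < 3 \<and> \<not> dash_after [[3], [1, 2]] (Suc r) \<longrightarrow> is ! Suc r = is ! r + 1"
      and b: "1 \<le> i" "i < j" "j < l" "l \<le> n"
      using o by (auto simp: occurrence_def e numeral_3_eq_3)
    have "l = j + 1" using adj[rule_format, of 1] by (simp add: d e)
    moreover have "\<pi> j < \<pi> l" using iso[rule_format, of 1 2] by (simp add: e)
    moreover have "\<pi> l < \<pi> i" using iso[rule_format, of 2 0] by (simp add: e)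
    ultimately show "is \<in> ?R" using b e by auto
  next
    fix "is" assume "is \<in> ?R"
    then show "is \<in> ?L"
      by (auto simp: occurrence_def d less_Suc_eq)
  qed
  moreover have "inj_on (\<lambda>(i, j). [i, j, j + 1]) S" for S :: "(nat \<times> nat) set"
    by (auto simp: inj_on_def)
  ultimately show ?thesis
    unfolding occ_def by (simp add: card_image)
qed

lemma occ_ba: "occ [[2, 1]] n \<pi> = card {i. 1 \<le> i \<and> i < n \<and> \<pi> i > \<pi> (i + 1)}"
proof -
  have d: "dash_after [[x, y]] (Suc r) \<longleftrightarrow> r = 1" for x y r
    unfolding dash_after_def by (auto simp: le_Suc_eq ex_disj_distrib conj_disj_distribR)
  have "{is. occurrence [[2, 1]] n \<pi> is} = (\<lambda>i. [i, i + 1]) `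
     {i. 1 \<le> i \<and> i < n \<and> \<pi> i > \<pi> (i + 1)}"
    by (auto simp: occurrence_def d image_iff length_Suc_conv less_Suc_eq)
  moreover have "inj_on (\<lambda>i. [i, i + 1]) S" for S :: "nat set"
    by (auto simp: inj_on_def)
  ultimately show ?thesis
    unfolding occ_def by (simp add: card_image)
qed

end

theory Submission
  imports Defs "HOL-Library.FuncSet"
begin

text \<open>
  Build a permutation by appending letters on the right, recording for each letter only its rank
  among the letters to its left. In all the patterns involved, the last two letters are adjacent,
  so appending a letter of rank \<open>x\<close> after a last letter of rank \<open>y\<close> to a word of length \<open>j\<close>
  increases the statistic by an amount that depends only on \<open>j\<close>, \<open>y\<close> and \<open>x\<close>. For fixed \<open>j\<close> and
  \<open>y\<close>, each of the numbers \<open>0, \<dots>, j\<close> arises from exactly one \<open>x\<close>. Hence the increments form a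
  code which maps \<open>\<SS>\<^sub>n\<close> bijectively onto \<open>{0} \<times> {0, 1} \<times> \<dots> \<times> {0, \<dots>, n - 1}\<close> and whose sum is
  the statistic. The same is true of \<open>inv\<close>, with the increment \<open>j - x\<close>.
\<close>

section \<open>Left ranks and the permutation they determine\<close>

definition left_rank :: "(nat \<Rightarrow> nat) \<Rightarrow> nat \<Rightarrow> nat" where
  "left_rank \<pi> j = card {i. 1 \<le> i \<and> i < j \<and> \<pi> i < \<pi> j}"

text \<open>Position 0 carries no letter; its rank 0 acts as the rank of a dummy predecessor of the
  first letter.\<close>

lemma left_rank_0 [simp]: "left_rank \<pi> 0 = 0" "left_rank \<pi> (Suc 0) = 0"
  unfolding left_rank_def by (auto simp: card_eq_0_iff)

lemma left_rank_le: "left_rank \<pi> j \<le> j - 1"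
proof -
  have "left_rank \<pi> j \<le> card {1..<j}"
    unfolding left_rank_def by (rule card_mono) auto
  then show ?thesis by simp
qed

text \<open>Induction on the length: an initial segment of a known order is determined by its size,
  and the common left rank gives the size of the segment below the last letter. Formulated for
  injections because a permutation cut down to its first \<open>n\<close> positions need not permute
  \<open>{1..n}\<close>.\<close>

lemma left_rank_determines_order:
  assumes "inj_on \<pi> {1..n}" "inj_on \<sigma> {1..n}"
    and "\<And>j. j \<in> {1..n} \<Longrightarrow> left_rank \<pi> j = left_rank \<sigma> j"
    and "i \<in> {1..n}" "j \<in> {1..n}"
  shows "\<pi> i < \<pi> j \<longleftrightarrow> \<sigma> i < \<sigma> j"
  using assms
proof (induction n arbitrary: i j)
  case 0
  then show ?case by simp
next
  case (Suc n)
  have IH: "\<pi> i < \<pi> j \<longleftrightarrow> \<sigma> i < \<sigma> j" if "i \<in> {1..n}" "j \<in> {1..n}" for i j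
    using that Suc.prems(3)
    by (intro Suc.IH inj_on_subset[OF Suc.prems(1)] inj_on_subset[OF Suc.prems(2)]) auto
  define below where "below \<rho> = {i. 1 \<le> i \<and> i < Suc n \<and> \<rho> i < \<rho> (Suc n)}" for \<rho> :: "nat \<Rightarrow> nat"
  have fin: "finite (below \<rho>)" for \<rho>
    unfolding below_def by (rule finite_subset[of _ "{..n}"]) auto
  have card_eq: "card (below \<pi>) = card (below \<sigma>)"
    using Suc.prems(3)[of "Suc n"] by (simp add: left_rank_def below_def)
  \<comment> \<open>Both sets are initial segments of the same linear order on the first \<open>n\<close> positions.\<close>
  have sub: "below \<rho> \<subseteq> below \<tau>"
    if inj: "inj_on \<tau> {1..Suc n}" and card_le: "card (below \<rho>) \<le> card (below \<tau>)"
      and ord: "\<And>i j. i \<in> {1..n} \<Longrightarrow> j \<in> {1..n} \<Longrightarrow> \<rho> i < \<rho> j \<longleftrightarrow> \<tau> i < \<tau> j"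
    for \<rho> \<tau>
  proof
    fix i assume i: "i \<in> below \<rho>"
    show "i \<in> below \<tau>"
    proof (rule ccontr)
      assume "i \<notin> below \<tau>"
      moreover have "\<tau> i \<noteq> \<tau> (Suc n)"
        using inj_onD[OF inj, of i "Suc n"] i by (auto simp: below_def)
      ultimately have *: "\<tau> (Suc n) < \<tau> i" using i by (auto simp: below_def)
      \<comment> \<open>Whatever \<open>\<tau>\<close> places below its last letter lies
        \<open>\<tau>\<close>-below \<open>i\<close>, hence \<open>\<rho>\<close>-below
        \<open>i\<close>, hence \<open>\<rho>\<close>-below the last letter. The position
        \<open>i\<close> makes the inclusion strict, against \<open>card_le\<close>.\<close>
      have "below \<tau> \<subset> below \<rho>"
      proof
        show "below \<tau> \<subseteq> below \<rho>"
        proof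
          fix k assume k: "k \<in> below \<tau>"
          then have "\<tau> k < \<tau> i" using * by (auto simp: below_def)
          then have "\<rho> k < \<rho> i" using ord[of k i] i k by (auto simp: below_def)
          then show "k \<in> below \<rho>" using i k by (auto simp: below_def)
        qed
        show "below \<tau> \<noteq> below \<rho>" using i \<open>i \<notin> below \<tau>\<close> by blast
      qed
      then show False using psubset_card_mono[OF fin] card_le by (meson not_le)
    qed
  qed
  have below_eq: "below \<pi> = below \<sigma>"
    using sub[of \<sigma> \<pi>] sub[of \<pi> \<sigma>] Suc.prems(1,2) card_eq IH by (simp add: subset_antisym)
  have last: "\<pi> k < \<pi> (Suc n) \<longleftrightarrow> \<sigma> k < \<sigma> (Suc n)" if "k \<in> {1..n}" for k
    using eqset_imp_iff[OF below_eq, of k] that by (simp add: below_def less_Suc_eq_le)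
  have last': "\<pi> (Suc n) < \<pi> k \<longleftrightarrow> \<sigma> (Suc n) < \<sigma> k" if "k \<in> {1..n}" for k
  proof -
    have "\<pi> k \<noteq> \<pi> (Suc n)" "\<sigma> k \<noteq> \<sigma> (Suc n)"
      using that inj_onD[OF Suc.prems(1), of k "Suc n"] inj_onD[OF Suc.prems(2), of k "Suc n"]
      by auto
    then show ?thesis using last[OF that] by linarith
  qed
  show ?case
    using Suc.prems(4,5) IH last last' by (auto simp: le_Suc_eq)
qed

text \<open>Recovers values from comparisons: since \<open>\<pi>\<close> maps onto
  \<open>{1..n}\<close>, every value in \<open>{1..<\<pi> j}\<close> is taken.\<close>

lemma permutes_eq_rank:
  assumes "\<pi> permutes {1..n}" "j \<in> {1..n}"
  shows "\<pi> j = Suc (card {i \<in> {1..n}. \<pi> i < \<pi> j})"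
proof -
  have "\<pi> ` {i \<in> {1..n}. \<pi> i < \<pi> j} = {1..<\<pi> j}"
  proof (intro set_eqI iffI)
    fix v assume "v \<in> \<pi> ` {i \<in> {1..n}. \<pi> i < \<pi> j}"
    then show "v \<in> {1..<\<pi> j}" using permutes_in_image[OF assms(1)] by auto
  next
    fix v assume v: "v \<in> {1..<\<pi> j}"
    have "\<pi> j \<in> {1..n}" using assms by (simp only: permutes_in_image)
    then have "v \<in> {1..n}" using v by auto
    then have "v \<in> \<pi> ` {1..n}" using permutes_image[OF assms(1)] by simp
    then show "v \<in> \<pi> ` {i \<in> {1..n}. \<pi> i < \<pi> j}" using v by auto
  qed
  then have "card {i \<in> {1..n}. \<pi> i < \<pi> j} = card {1..<\<pi> j}"
    using card_image[OF permutes_inj_on[OF assms(1)]] by metis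
  moreover have "\<pi> j \<in> {1..n}" using assms by (simp only: permutes_in_image)
  ultimately show ?thesis by simp
qed

lemma permutes_eqI_left_rank:
  assumes "\<pi> permutes {1..n}" "\<sigma> permutes {1..n}"
    and "\<And>j. j \<in> {1..n} \<Longrightarrow> left_rank \<pi> j = left_rank \<sigma> j"
  shows "\<pi> = \<sigma>"
proof
  fix j
  show "\<pi> j = \<sigma> j"
  proof (cases "j \<in> {1..n}")
    case True
    have "{i \<in> {1..n}. \<pi> i < \<pi> j} = {i \<in> {1..n}. \<sigma> i < \<sigma> j}"
      using left_rank_determines_order[of \<pi> n \<sigma> _ j] assms True permutes_inj_on by blast
    then show ?thesis
      using permutes_eq_rank[OF assms(1) True] permutes_eq_rank[OF assms(2) True] by simp
  next
    case False
    then show ?thesis using assms by (simp add: permutes_not_in)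
  qed
qed

section \<open>Insertion codes and equidistribution\<close>

text \<open>Entry \<open>j\<close> belongs to appending the letter at position \<open>Suc j\<close>
  to a word of length \<open>j\<close>, whose last letter is at position \<open>j\<close>. The
  restriction to \<open>{..<n}\<close> makes codes elements of a finite product set.\<close>

definition insertion_code ::
    "(nat \<Rightarrow> nat \<Rightarrow> nat \<Rightarrow> nat) \<Rightarrow> nat \<Rightarrow> (nat \<Rightarrow> nat) \<Rightarrow> nat \<Rightarrow> nat" where
  "insertion_code f n \<pi> = (\<lambda>j\<in>{..<n}. f j (left_rank \<pi> j) (left_rank \<pi> (Suc j)))"

text \<open>Codes can be decoded from left to right, which gives injectivity; surjectivity follows
  by counting, as both sides have \<open>fact n\<close> elements.\<close>

lemma bij_betw_insertion_code:
  assumes le: "\<And>j y x. y \<le> j \<Longrightarrow> x \<le> j \<Longrightarrow> f j y x \<le> j"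
    and inj: "\<And>j y. y \<le> j \<Longrightarrow> inj_on (f j y) {..j}"
  shows "bij_betw (insertion_code f n) {\<pi>. \<pi> permutes {1..n}} (\<Pi>\<^sub>E j\<in>{..<n}. {..j})"
proof -
  have rank_le: "left_rank \<pi> j \<le> j" "left_rank \<pi> (Suc j) \<le> j" for \<pi> j
    using left_rank_le[of \<pi> j] left_rank_le[of \<pi> "Suc j"] by auto
  have inj_code: "inj_on (insertion_code f n) {\<pi>. \<pi> permutes {1..n}}"
  proof (rule inj_onI; clarify)
    fix \<pi> \<sigma> :: "nat \<Rightarrow> nat"
    assume perm: "\<pi> permutes {1..n}" "\<sigma> permutes {1..n}"
      and eq: "insertion_code f n \<pi> = insertion_code f n \<sigma>"
    \<comment> \<open>Decoding starts from the dummy rank 0. Once the rank \<open>y\<close> at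
      \<open>j\<close> is known, \<open>f j y\<close> is a known injective map, so entry
      \<open>j\<close> reveals the rank at \<open>Suc j\<close>.\<close>
    have "j \<le> n \<Longrightarrow> left_rank \<pi> j = left_rank \<sigma> j" for j
    proof (induction j)
      case 0
      then show ?case by simp
    next
      case (Suc j)
      have "f j (left_rank \<pi> j) (left_rank \<pi> (Suc j)) = f j (left_rank \<pi> j) (left_rank \<sigma> (Suc j))"
        using fun_cong[OF eq, of j] Suc by (simp add: insertion_code_def)
      then show ?case
        using inj_onD[OF inj[OF rank_le(1)]] rank_le(2) by blast
    qed
    then show "\<pi> = \<sigma>" using permutes_eqI_left_rank[OF perm] by simp
  qed
  have sub: "insertion_code f n ` {\<pi>. \<pi> permutes {1..n}} \<subseteq> (\<Pi>\<^sub>E j\<in>{..<n}. {..j})"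
    unfolding insertion_code_def using le rank_le by (intro image_subsetI restrict_PiE[THEN iffD2]) auto
  have "card (\<Pi>\<^sub>E j\<in>{..<n}. {..j}) = fact n"
    by (simp add: card_PiE fact_prod_Suc lessThan_atLeast0)
  also have "\<dots> = card (insertion_code f n ` {\<pi>. \<pi> permutes {1..n}})"
    using card_image[OF inj_code] card_permutations[of "{1..n}" n] by simp
  finally have "insertion_code f n ` {\<pi>. \<pi> permutes {1..n}} = (\<Pi>\<^sub>E j\<in>{..<n}. {..j})"
    by (intro card_subset_eq sub finite_PiE) auto
  then show ?thesis using inj_code by (simp add: bij_betw_def)
qed

text \<open>The right-hand side mentions neither \<open>f\<close> nor \<open>stat\<close>, so any
  two statistics with increments of this kind are equidistributed.\<close>

lemma card_statistic_eq_card_codes: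
  assumes "\<And>j y x. y \<le> j \<Longrightarrow> x \<le> j \<Longrightarrow> f j y x \<le> j"
    and "\<And>j y. y \<le> j \<Longrightarrow> inj_on (f j y) {..j}"
    and stat: "\<And>\<pi>. \<pi> permutes {1..n} \<Longrightarrow>
      stat \<pi> = (\<Sum>j<n. f j (left_rank \<pi> j) (left_rank \<pi> (Suc j)))"
  shows "card {\<pi>. \<pi> permutes {1..n} \<and> int (stat \<pi>) = k} =
    card {c \<in> \<Pi>\<^sub>E j\<in>{..<n}. {..j}. int (\<Sum>j<n. c j) = k}"
proof -
  have bij: "bij_betw (insertion_code f n) {\<pi>. \<pi> permutes {1..n}} (\<Pi>\<^sub>E j\<in>{..<n}. {..j})"
    using assms(1,2) by (rule bij_betw_insertion_code)
  have sum: "(\<Sum>j<n. insertion_code f n \<pi> j) = stat \<pi>" if "\<pi> permutes {1..n}" for \<pi>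
    by (simp add: stat[OF that] insertion_code_def)
  let ?A = "{\<pi>. \<pi> permutes {1..n} \<and> int (stat \<pi>) = k}"
  have "insertion_code f n ` ?A = {c \<in> insertion_code f n ` {\<pi>. \<pi> permutes {1..n}}. int (\<Sum>j<n. c j) = k}"
    by (auto simp: sum simp del: of_nat_sum)
  also have "\<dots> = {c \<in> \<Pi>\<^sub>E j\<in>{..<n}. {..j}. int (\<Sum>j<n. c j) = k}"
    using bij_betw_imp_surj_on[OF bij] by simp
  finally have "insertion_code f n ` ?A = {c \<in> \<Pi>\<^sub>E j\<in>{..<n}. {..j}. int (\<Sum>j<n. c j) = k}" .
  moreover have "inj_on (insertion_code f n) ?A"
    using bij_betw_imp_inj_on[OF bij] by (rule inj_on_subset) auto
  ultimately show ?thesis using card_image by fastforce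
qed

section \<open>Counting pairs and letters; inversions as a sum\<close>

lemma card_pairs_eq_sum:
  "card {(i, j). 1 \<le> i \<and> i < j \<and> j < n \<and> P i j} = (\<Sum>j<n. card {i. 1 \<le> i \<and> i < j \<and> P i j})"
  for n :: nat
proof -
  have "{(i, j). 1 \<le> i \<and> i < j \<and> j < n \<and> P i j} =
      prod.swap ` (SIGMA j:{..<n}. {i. 1 \<le> i \<and> i < j \<and> P i j})"
    by (auto simp: image_iff)
  moreover have "finite {i. 1 \<le> i \<and> i < j \<and> P i j}" for j
    by (rule finite_subset[of _ "{..<j}"]) auto
  ultimately show ?thesis
    by (simp add: card_image)
qed

text \<open>As \<open>v\<close> does not occur before position \<open>j\<close>, the
  \<open>j - 1\<close> letters there split into those above and those below
  \<open>v\<close>.\<close>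

lemma card_greater:
  fixes \<pi> :: "nat \<Rightarrow> nat"
  assumes "v \<notin> \<pi> ` {1..<j}"
  shows "card {i. 1 \<le> i \<and> i < j \<and> v < \<pi> i} = (j - 1) - card {i. 1 \<le> i \<and> i < j \<and> \<pi> i < v}"
proof -
  have "{i. 1 \<le> i \<and> i < j \<and> v < \<pi> i} = {1..<j} - {i. 1 \<le> i \<and> i < j \<and> \<pi> i < v}"
    using assms by (auto simp: image_iff)
  moreover have "{i. 1 \<le> i \<and> i < j \<and> \<pi> i < v} \<subseteq> {1..<j}" by auto
  ultimately show ?thesis
    by (simp add: card_Diff_subset finite_subset[of _ "{1..<j}"])
qed

lemma card_between:
  fixes \<pi> :: "nat \<Rightarrow> nat"
  assumes "u \<notin> \<pi> ` {1..<j}" "u \<le> v"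
  shows "card {i. 1 \<le> i \<and> i < j \<and> u < \<pi> i \<and> \<pi> i < v} =
    card {i. 1 \<le> i \<and> i < j \<and> \<pi> i < v} - card {i. 1 \<le> i \<and> i < j \<and> \<pi> i < u}"
proof -
  have "{i. 1 \<le> i \<and> i < j \<and> u < \<pi> i \<and> \<pi> i < v} =
      {i. 1 \<le> i \<and> i < j \<and> \<pi> i < v} - {i. 1 \<le> i \<and> i < j \<and> \<pi> i < u}"
    using assms by (force simp: image_iff not_less le_less)
  moreover have "{i. 1 \<le> i \<and> i < j \<and> \<pi> i < u} \<subseteq> {i. 1 \<le> i \<and> i < j \<and> \<pi> i < v}"
    using assms(2) by auto
  moreover have "finite {i. 1 \<le> i \<and> i < j \<and> \<pi> i < u}"
    by (rule finite_subset[of _ "{1..<j}"]) auto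
  ultimately show ?thesis
    by (simp add: card_Diff_subset)
qed

lemma inversions_eq_sum:
  assumes "\<pi> permutes {1..n}"
  shows "inversions n \<pi> = (\<Sum>j<n. j - left_rank \<pi> (Suc j))"
proof -
  have "inversions n \<pi> = card {(i, j). 1 \<le> i \<and> i < j \<and> j < Suc n \<and> \<pi> j < \<pi> i}"
    by (simp add: inversions_def less_Suc_eq_le)
  also have "\<dots> = (\<Sum>j<n. card {i. 1 \<le> i \<and> i < Suc j \<and> \<pi> (Suc j) < \<pi> i})"
    \<comment> \<open>The right ends run over \<open>0, ..., n\<close>. The term for 0 is empty, and
      an index shift leaves the right ends \<open>Suc j\<close> with \<open>j < n\<close>, each
      preceded by \<open>j\<close> letters.\<close>
    by (subst card_pairs_eq_sum) (simp add: sum.lessThan_Suc_shift del: sum.lessThan_Suc)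
  also have "\<dots> = (\<Sum>j<n. j - left_rank \<pi> (Suc j))"
  proof (rule sum.cong)
    fix j assume "j \<in> {..<n}"
    have "\<pi> (Suc j) \<notin> \<pi> ` {1..<Suc j}"
      by (simp add: inj_image_mem_iff[OF permutes_inj[OF assms]])
    then show "card {i. 1 \<le> i \<and> i < Suc j \<and> \<pi> (Suc j) < \<pi> i} = j - left_rank \<pi> (Suc j)"
      using card_greater by (simp add: left_rank_def)
  qed simp
  finally show ?thesis .
qed

lemma mahonianI:
  assumes "\<And>j y x. y \<le> j \<Longrightarrow> x \<le> j \<Longrightarrow> f j y x \<le> j"
    and "\<And>j y. y \<le> j \<Longrightarrow> inj_on (f j y) {..j}"
    and "\<And>n \<pi>. \<pi> permutes {1..n} \<Longrightarrow>
      stat n \<pi> = (\<Sum>j<n. f j (left_rank \<pi> j) (left_rank \<pi> (Suc j)))"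
  shows "mahonian stat"
  unfolding mahonian_def
proof (intro allI impI)
  fix n :: nat and k :: int
  have "card {\<pi>. \<pi> permutes {1..n} \<and> int (stat n \<pi>) = k} =
      card {c \<in> \<Pi>\<^sub>E j\<in>{..<n}. {..j}. int (\<Sum>j<n. c j) = k}"
    using assms by (rule card_statistic_eq_card_codes)
  also have "\<dots> = card {\<pi>. \<pi> permutes {1..n} \<and> int (inversions n \<pi>) = k}"
    \<comment> \<open>For inversions the increment is the number \<open>j - x\<close> of earlier
      letters above the new one, whatever \<open>y\<close> is.\<close>
    by (rule card_statistic_eq_card_codes[symmetric, where f = "\<lambda>j y x. j - x"])
      (auto simp: inj_on_def inversions_eq_sum)
  finally show "card {\<pi>. \<pi> permutes {1..n} \<and> int (stat n \<pi>) = k} =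
      card {\<pi>. \<pi> permutes {1..n} \<and> int (inversions n \<pi>) = k}" .
qed

section \<open>Pattern occurrences summed over the position of the penultimate letter\<close>

text \<open>The dash-free block puts the last letter at \<open>Suc j\<close>, so the bound
  \<open>Suc j \<le> n\<close> becomes \<open>j < n\<close>. Order-isomorphism is spelled out over
  pairs of a value and its letter, so that a concrete pattern simplifies to inequalities.\<close>

lemma occ_1_2:
  "occ [[p], [q, r]] n \<pi> = (\<Sum>j<n. card {i. 1 \<le> i \<and> i < j \<and>
     (\<forall>(u, x) \<in> {(\<pi> i, p), (\<pi> j, q), (\<pi> (Suc j), r)}.
      \<forall>(v, y) \<in> {(\<pi> i, p), (\<pi> j, q), (\<pi> (Suc j), r)}. u < v \<longleftrightarrow> x < y)})"
  (is "_ = (\<Sum>j<n. card {i. 1 \<le> i \<and> i < j \<and> ?P i j})")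
proof -
  \<comment> \<open>Block boundaries come after 0, 1 and 3 letters, so adjacency is imposed only
    between the second and third letters.\<close>
  have d: "dash_after [[x], [y, z]] (Suc k) \<longleftrightarrow> k = 0 \<or> k = 2" for x y z k
    unfolding dash_after_def by (auto simp: le_Suc_eq ex_disj_distrib conj_disj_distribR)
  have iff: "occurrence [[p], [q, r]] n \<pi> is \<longleftrightarrow>
      (\<exists>i j. is = [i, j, Suc j] \<and> 1 \<le> i \<and> i < j \<and> j < n \<and> ?P i j)" for "is"
  proof
    assume o: "occurrence [[p], [q, r]] n \<pi> is"
    then obtain i j l where e: "is = [i, j, l]"
      by (auto simp: occurrence_def length_Suc_conv)
    have adj: "\<forall>k. Suc k < 3 \<and> \<not> dash_after [[p], [q, r]] (Suc k) \<longrightarrow> is ! Suc k = is ! k + 1"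
      and iso: "\<forall>k<3. \<forall>s<3. \<pi> (is ! k) < \<pi> (is ! s) \<longleftrightarrow> [p, q, r] ! k < [p, q, r] ! s"
      and b: "1 \<le> i" "i < j" "j < l" "l \<le> n"
      using o by (auto simp: occurrence_def e numeral_3_eq_3)
    have l: "l = Suc j" using adj[rule_format, of 1] by (simp add: d e)
    have "?P i j"
      using iso by (simp add: e l numeral_3_eq_3 All_less_Suc)
    then show "\<exists>i j. is = [i, j, Suc j] \<and> 1 \<le> i \<and> i < j \<and> j < n \<and> ?P i j"
      using b e l by auto
  next
    assume "\<exists>i j. is = [i, j, Suc j] \<and> 1 \<le> i \<and> i < j \<and> j < n \<and> ?P i j"
    then obtain i j where e: "is = [i, j, Suc j]" and ij: "1 \<le> i" "i < j" "j < n" and P: "?P i j"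
      by blast
    have iso: "\<forall>k<3. \<forall>s<3. \<pi> (is ! k) < \<pi> (is ! s) \<longleftrightarrow> [p, q, r] ! k < [p, q, r] ! s"
      using P by (simp add: e numeral_3_eq_3 All_less_Suc)
    have adj: "\<forall>k. Suc k < 3 \<and> \<not> dash_after [[p], [q, r]] (Suc k) \<longrightarrow> is ! Suc k = is ! k + 1"
      by (auto simp: e d numeral_3_eq_3 less_Suc_eq)
    show "occurrence [[p], [q, r]] n \<pi> is"
      using iso adj ij by (simp add: occurrence_def e numeral_3_eq_3)
  qed
  have "{is. occurrence [[p], [q, r]] n \<pi> is} =
      (\<lambda>(i, j). [i, j, Suc j]) ` {(i, j). 1 \<le> i \<and> i < j \<and> j < n \<and> ?P i j}"
    unfolding iff by (auto simp: image_iff)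
  moreover have "inj_on (\<lambda>(i, j). [i, j, Suc j]) S" for S :: "(nat \<times> nat) set"
    by (auto simp: inj_on_def)
  ultimately show ?thesis
    unfolding occ_def by (simp only: card_image card_pairs_eq_sum)
qed

text \<open>Same index range as in \<open>occ_1_2\<close>, to allow termwise addition; the guard
  \<open>1 \<le> j\<close> discards \<open>\<pi> 0\<close>, which is not a letter of the
  word.\<close>

lemma occ_ba_eq_sum: "occ [[2, 1]] n \<pi> = (\<Sum>j<n. if 1 \<le> j \<and> \<pi> (Suc j) < \<pi> j then 1 else 0)"
proof -
  have "{i. 1 \<le> i \<and> i < n \<and> \<pi> (i + 1) < \<pi> i} = {j \<in> {..<n}. 1 \<le> j \<and> \<pi> (Suc j) < \<pi> j}"
    by auto
  then show ?thesis
    unfolding occ_ba by (simp only: sum.inter_filter[symmetric] finite_lessThan card_eq_sum)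
qed

section \<open>The counts at each position in terms of left ranks\<close>

context
  fixes \<pi> :: "nat \<Rightarrow> nat"
  assumes inj: "inj \<pi>"
begin

lemma ascent_or_descent:
  obtains "\<pi> j < \<pi> (Suc j)" | "\<pi> (Suc j) < \<pi> j"
  using injD[OF inj, of j "Suc j"] by (metis n_not_Suc_n nat_neq_iff)

text \<open>The patterns count only positions \<open>i < j\<close>, whereas the rank at
  \<open>Suc j\<close> also counts position \<open>j\<close> if its letter is smaller: hence a shift
  by one at ascents and none at descents.\<close>

lemma left_rank_Suc_ascent:
  assumes "1 \<le> j" "\<pi> j < \<pi> (Suc j)"
  shows "left_rank \<pi> (Suc j) = Suc (card {i. 1 \<le> i \<and> i < j \<and> \<pi> i < \<pi> (Suc j)})"
proof -
  have "{i. 1 \<le> i \<and> i < Suc j \<and> \<pi> i < \<pi> (Suc j)} =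
      insert j {i. 1 \<le> i \<and> i < j \<and> \<pi> i < \<pi> (Suc j)}"
    using assms by (auto simp: less_Suc_eq)
  moreover have "finite {i. 1 \<le> i \<and> i < j \<and> \<pi> i < \<pi> (Suc j)}"
    by (rule finite_subset[of _ "{1..<j}"]) auto
  ultimately show ?thesis by (simp add: left_rank_def)
qed

lemma left_rank_Suc_descent:
  assumes "\<pi> (Suc j) < \<pi> j"
  shows "left_rank \<pi> (Suc j) = card {i. 1 \<le> i \<and> i < j \<and> \<pi> i < \<pi> (Suc j)}"
proof -
  have "{i. 1 \<le> i \<and> i < Suc j \<and> \<pi> i < \<pi> (Suc j)} = {i. 1 \<le> i \<and> i < j \<and> \<pi> i < \<pi> (Suc j)}"
    using assms by (auto simp: less_Suc_eq)
  then show ?thesis by (simp add: left_rank_def)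
qed

text \<open>At a descent, earlier letters below the new one are also below \<open>\<pi> j\<close>;
  at an ascent, position \<open>j\<close> itself raises the rank. The case \<open>j = 0\<close> is
  excluded because both ranks are then 0, whatever \<open>\<pi> 0\<close> is.\<close>

lemma left_rank_Suc_le_iff:
  assumes "1 \<le> j"
  shows "left_rank \<pi> (Suc j) \<le> left_rank \<pi> j \<longleftrightarrow> \<pi> (Suc j) < \<pi> j"
proof -
  have fin: "finite {i. 1 \<le> i \<and> i < j \<and> \<pi> i < v}" for v
    by (rule finite_subset[of _ "{1..<j}"]) auto
  consider "\<pi> j < \<pi> (Suc j)" | "\<pi> (Suc j) < \<pi> j" by (rule ascent_or_descent)
  then show ?thesis
  proof cases
    case 1
    have "left_rank \<pi> j \<le> card {i. 1 \<le> i \<and> i < j \<and> \<pi> i < \<pi> (Suc j)}"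
      unfolding left_rank_def using 1 by (intro card_mono fin) auto
    then show ?thesis using 1 left_rank_Suc_ascent[OF assms 1] by simp
  next
    case 2
    have "left_rank \<pi> (Suc j) \<le> left_rank \<pi> j"
      unfolding left_rank_Suc_descent[OF 2] left_rank_def[of \<pi> j] using 2
      by (intro card_mono fin) auto
    then show ?thesis using 2 by simp
  qed
qed

lemma not_in_image:
  "\<pi> j \<notin> \<pi> ` {1..<j}" "\<pi> (Suc j) \<notin> \<pi> ` {1..<j}"
  by (simp_all add: inj_image_mem_iff[OF inj])

text \<open>At a descent, every earlier letter below the new one completes an occurrence. Here and
  in the next four counts, \<open>j = 0\<close> falls into the \<open>\<le>\<close> branch, as both
  ranks vanish, and contributes 0.\<close>

lemma card_a_cb:
  "card {i. 1 \<le> i \<and> i < j \<and> \<pi> i < \<pi> (Suc j) \<and> \<pi> (Suc j) < \<pi> j} =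
    (if left_rank \<pi> (Suc j) \<le> left_rank \<pi> j then left_rank \<pi> (Suc j) else 0)"
proof (cases "j = 0")
  case False
  then have j: "1 \<le> j" by simp
  show ?thesis
    unfolding left_rank_Suc_le_iff[OF j] by (simp add: left_rank_Suc_descent)
qed simp

lemma card_b_ac:
  "card {i. 1 \<le> i \<and> i < j \<and> \<pi> j < \<pi> i \<and> \<pi> i < \<pi> (Suc j)} =
    (if left_rank \<pi> (Suc j) \<le> left_rank \<pi> j then 0 else left_rank \<pi> (Suc j) - left_rank \<pi> j - 1)"
proof (cases "j = 0")
  case False
  then have j: "1 \<le> j" by simp
  consider "\<pi> j < \<pi> (Suc j)" | "\<pi> (Suc j) < \<pi> j" by (rule ascent_or_descent)
  then show ?thesis
  proof cases
    case 1
    \<comment> \<open>Before position \<open>j\<close>, exactly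
      \<open>left_rank \<pi> (Suc j) - 1\<close> letters lie below the new one; those below
      \<open>\<pi> j\<close> are subtracted.\<close>
    then show ?thesis
      using card_between[OF not_in_image(1), of j "\<pi> (Suc j)"] left_rank_Suc_ascent[OF j 1]
      by (simp add: left_rank_Suc_le_iff[OF j] left_rank_def[of _ j])
  next
    case 2
    then have none: "{i. 1 \<le> i \<and> i < j \<and> \<pi> j < \<pi> i \<and> \<pi> i < \<pi> (Suc j)} = {}" by auto
    show ?thesis using 2 unfolding none by (simp add: left_rank_Suc_le_iff[OF j])
  qed
qed simp

lemma card_b_ca:
  "card {i. 1 \<le> i \<and> i < j \<and> \<pi> (Suc j) < \<pi> i \<and> \<pi> i < \<pi> j} =
    (if left_rank \<pi> (Suc j) \<le> left_rank \<pi> j then left_rank \<pi> j - left_rank \<pi> (Suc j) else 0)"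
proof (cases "j = 0")
  case False
  then have j: "1 \<le> j" by simp
  consider "\<pi> j < \<pi> (Suc j)" | "\<pi> (Suc j) < \<pi> j" by (rule ascent_or_descent)
  then show ?thesis
  proof cases
    case 1
    then have none: "{i. 1 \<le> i \<and> i < j \<and> \<pi> (Suc j) < \<pi> i \<and> \<pi> i < \<pi> j} = {}" by auto
    show ?thesis using 1 unfolding none by (simp add: left_rank_Suc_le_iff[OF j])
  next
    case 2
    then show ?thesis
      using card_between[OF not_in_image(2), of j "\<pi> j"] left_rank_Suc_descent[OF 2]
      by (simp add: left_rank_Suc_le_iff[OF j] left_rank_def[of _ j])
  qed
qed simp

lemma card_c_ba:
  "card {i. 1 \<le> i \<and> i < j \<and> \<pi> j < \<pi> i \<and> \<pi> (Suc j) < \<pi> j} =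
    (if left_rank \<pi> (Suc j) \<le> left_rank \<pi> j then j - 1 - left_rank \<pi> j else 0)"
proof (cases "j = 0")
  case False
  then have j: "1 \<le> j" by simp
  show ?thesis
    unfolding left_rank_Suc_le_iff[OF j]
    using card_greater[OF not_in_image(1), of j] by (simp add: left_rank_def[of _ j])
qed simp

lemma card_c_ab:
  "card {i. 1 \<le> i \<and> i < j \<and> \<pi> (Suc j) < \<pi> i \<and> \<pi> j < \<pi> (Suc j)} =
    (if left_rank \<pi> (Suc j) \<le> left_rank \<pi> j then 0 else j - left_rank \<pi> (Suc j))"
proof (cases "j = 0")
  case False
  then have j: "1 \<le> j" by simp
  consider "\<pi> j < \<pi> (Suc j)" | "\<pi> (Suc j) < \<pi> j" by (rule ascent_or_descent)
  then show ?thesis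
  proof cases
    case 1
    \<comment> \<open>The count is \<open>(j - 1) - (x - 1) = j - x\<close> for the rank
      \<open>x\<close> of the new letter, as \<open>x\<close> is at least 1 at an ascent.\<close>
    then show ?thesis
      unfolding left_rank_Suc_le_iff[OF j]
      using card_greater[OF not_in_image(2), of j] left_rank_Suc_ascent[OF j 1] by simp
  qed (simp add: left_rank_Suc_le_iff[OF j])
qed simp

lemma occ_eq_sum_left_rank:
  "occ [[1], [3, 2]] n \<pi> =
    (\<Sum>j<n. if left_rank \<pi> (Suc j) \<le> left_rank \<pi> j then left_rank \<pi> (Suc j) else 0)"
  "occ [[2], [1, 3]] n \<pi> =
    (\<Sum>j<n. if left_rank \<pi> (Suc j) \<le> left_rank \<pi> j then 0
      else left_rank \<pi> (Suc j) - left_rank \<pi> j - 1)"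
  "occ [[2], [3, 1]] n \<pi> =
    (\<Sum>j<n. if left_rank \<pi> (Suc j) \<le> left_rank \<pi> j then left_rank \<pi> j - left_rank \<pi> (Suc j) else 0)"
  "occ [[3], [2, 1]] n \<pi> =
    (\<Sum>j<n. if left_rank \<pi> (Suc j) \<le> left_rank \<pi> j then j - 1 - left_rank \<pi> j else 0)"
  "occ [[3], [1, 2]] n \<pi> =
    (\<Sum>j<n. if left_rank \<pi> (Suc j) \<le> left_rank \<pi> j then 0 else j - left_rank \<pi> (Suc j))"
  "occ [[2, 1]] n \<pi> =
    (\<Sum>j<n. if 1 \<le> j \<and> left_rank \<pi> (Suc j) \<le> left_rank \<pi> j then 1 else 0)"
proof -
  show "occ [[1], [3, 2]] n \<pi> =
    (\<Sum>j<n. if left_rank \<pi> (Suc j) \<le> left_rank \<pi> j then left_rank \<pi> (Suc j) else 0)"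
    unfolding occ_1_2 card_a_cb[symmetric]
    by (intro sum.cong arg_cong[where f = card] Collect_cong) auto
  show "occ [[2], [1, 3]] n \<pi> =
    (\<Sum>j<n. if left_rank \<pi> (Suc j) \<le> left_rank \<pi> j then 0
      else left_rank \<pi> (Suc j) - left_rank \<pi> j - 1)"
    unfolding occ_1_2 card_b_ac[symmetric]
    by (intro sum.cong arg_cong[where f = card] Collect_cong) auto
  show "occ [[2], [3, 1]] n \<pi> =
    (\<Sum>j<n. if left_rank \<pi> (Suc j) \<le> left_rank \<pi> j then left_rank \<pi> j - left_rank \<pi> (Suc j) else 0)"
    unfolding occ_1_2 card_b_ca[symmetric]
    by (intro sum.cong arg_cong[where f = card] Collect_cong) auto
  show "occ [[3], [2, 1]] n \<pi> =
    (\<Sum>j<n. if left_rank \<pi> (Suc j) \<le> left_rank \<pi> j then j - 1 - left_rank \<pi> j else 0)"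
    unfolding occ_1_2 card_c_ba[symmetric]
    by (intro sum.cong arg_cong[where f = card] Collect_cong) auto
  show "occ [[3], [1, 2]] n \<pi> =
    (\<Sum>j<n. if left_rank \<pi> (Suc j) \<le> left_rank \<pi> j then 0 else j - left_rank \<pi> (Suc j))"
    unfolding occ_1_2 card_c_ab[symmetric]
    by (intro sum.cong arg_cong[where f = card] Collect_cong) auto
  show "occ [[2, 1]] n \<pi> =
    (\<Sum>j<n. if 1 \<le> j \<and> left_rank \<pi> (Suc j) \<le> left_rank \<pi> j then 1 else 0)"
    unfolding occ_ba_eq_sum by (intro sum.cong) (auto simp: left_rank_Suc_le_iff)
qed

end

section \<open>The three statistics and their increments\<close>

text \<open>Put \<open>y = left_rank \<pi> j\<close> and \<open>x = left_rank \<pi> (Suc j)\<close>.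
  The terms at a descent add up to \<open>x + (j - 1 - y) + 1\<close> in the first and third
  statistics and to \<open>(y - x) + (j - 1 - y) + 1\<close> in the second; at an ascent only
  \<open>b-ac\<close> or \<open>c-ab\<close> contributes.\<close>

lemma
  assumes "\<pi> permutes {1..n}"
  shows stat1_eq_sum:
    "occ [[1], [3, 2]] n \<pi> + occ [[2], [1, 3]] n \<pi> + occ [[3], [2, 1]] n \<pi> + occ [[2, 1]] n \<pi> =
      (\<Sum>j<n. if left_rank \<pi> (Suc j) \<le> left_rank \<pi> j
        then j + left_rank \<pi> (Suc j) - left_rank \<pi> j
        else left_rank \<pi> (Suc j) - left_rank \<pi> j - 1)"
    and stat2_eq_sum:
    "occ [[2], [1, 3]] n \<pi> + occ [[2], [3, 1]] n \<pi> + occ [[3], [2, 1]] n \<pi> + occ [[2, 1]] n \<pi> =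
      (\<Sum>j<n. if left_rank \<pi> (Suc j) \<le> left_rank \<pi> j
        then j - left_rank \<pi> (Suc j)
        else left_rank \<pi> (Suc j) - left_rank \<pi> j - 1)"
    and stat3_eq_sum:
    "occ [[1], [3, 2]] n \<pi> + occ [[3], [1, 2]] n \<pi> + occ [[3], [2, 1]] n \<pi> + occ [[2, 1]] n \<pi> =
      (\<Sum>j<n. if left_rank \<pi> (Suc j) \<le> left_rank \<pi> j
        then j + left_rank \<pi> (Suc j) - left_rank \<pi> j
        else j - left_rank \<pi> (Suc j))"
proof -
  note sums = occ_eq_sum_left_rank[OF permutes_inj[OF assms]] sum.distrib[symmetric]
  have le: "left_rank \<pi> j \<le> j - 1" for j by (rule left_rank_le)
  \<comment> \<open>For \<open>j \<ge> 1\<close> the bound makes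
    \<open>j - 1 - left_rank \<pi> j\<close> an exact difference; at \<open>j = 0\<close> it forces
    rank 0.\<close>
  have eq: "(\<Sum>j<n. g j) = (\<Sum>j<n. h j)" if "\<And>j. left_rank \<pi> j \<le> j - 1 \<Longrightarrow> g j = h j"
    for g h :: "nat \<Rightarrow> nat"
    using that le by simp
  show "occ [[1], [3, 2]] n \<pi> + occ [[2], [1, 3]] n \<pi> + occ [[3], [2, 1]] n \<pi> + occ [[2, 1]] n \<pi> =
      (\<Sum>j<n. if left_rank \<pi> (Suc j) \<le> left_rank \<pi> j
        then j + left_rank \<pi> (Suc j) - left_rank \<pi> j
        else left_rank \<pi> (Suc j) - left_rank \<pi> j - 1)"
    unfolding sums by (rule eq) (auto split: if_splits)
  show "occ [[2], [1, 3]] n \<pi> + occ [[2], [3, 1]] n \<pi> + occ [[3], [2, 1]] n \<pi> + occ [[2, 1]] n \<pi> =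
      (\<Sum>j<n. if left_rank \<pi> (Suc j) \<le> left_rank \<pi> j
        then j - left_rank \<pi> (Suc j)
        else left_rank \<pi> (Suc j) - left_rank \<pi> j - 1)"
    unfolding sums by (rule eq) (auto split: if_splits)
  show "occ [[1], [3, 2]] n \<pi> + occ [[3], [1, 2]] n \<pi> + occ [[3], [2, 1]] n \<pi> + occ [[2, 1]] n \<pi> =
      (\<Sum>j<n. if left_rank \<pi> (Suc j) \<le> left_rank \<pi> j
        then j + left_rank \<pi> (Suc j) - left_rank \<pi> j
        else j - left_rank \<pi> (Suc j))"
    unfolding sums by (rule eq) (auto split: if_splits)
qed

theorem theorem3:
  shows "mahonian (\<lambda>n \<pi>. occ [[1], [3, 2]] n \<pi> + occ [[2], [1, 3]] n \<pi>
                       + occ [[3], [2, 1]] n \<pi> + occ [[2, 1]] n \<pi>)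
       \<and> mahonian (\<lambda>n \<pi>. occ [[2], [1, 3]] n \<pi> + occ [[2], [3, 1]] n \<pi>
                       + occ [[3], [2, 1]] n \<pi> + occ [[2, 1]] n \<pi>)
       \<and> mahonian (\<lambda>n \<pi>. occ [[1], [3, 2]] n \<pi> + occ [[3], [1, 2]] n \<pi>
                       + occ [[3], [2, 1]] n \<pi> + occ [[2, 1]] n \<pi>)"
proof (intro conjI)
  show "mahonian (\<lambda>n \<pi>. occ [[1], [3, 2]] n \<pi> + occ [[2], [1, 3]] n \<pi>
                       + occ [[3], [2, 1]] n \<pi> + occ [[2, 1]] n \<pi>)"
    \<comment> \<open>For fixed \<open>y\<close>, the values at \<open>x \<le> y\<close> are
      \<open>j - y, ..., j\<close> and those at \<open>x > y\<close> are
      \<open>0, ..., j - y - 1\<close>, both in increasing order, so none repeats.\<close>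
    by (rule mahonianI[where f = "\<lambda>j y x. if x \<le> y then j + x - y else x - y - 1",
          OF _ _ stat1_eq_sum])
      (auto simp: inj_on_def split: if_splits)
  show "mahonian (\<lambda>n \<pi>. occ [[2], [1, 3]] n \<pi> + occ [[2], [3, 1]] n \<pi>
                       + occ [[3], [2, 1]] n \<pi> + occ [[2, 1]] n \<pi>)"
    \<comment> \<open>The same two ranges, the values at \<open>x \<le> y\<close> now in decreasing
      order.\<close>
    by (rule mahonianI[where f = "\<lambda>j y x. if x \<le> y then j - x else x - y - 1",
          OF _ _ stat2_eq_sum])
      (auto simp: inj_on_def split: if_splits)
  show "mahonian (\<lambda>n \<pi>. occ [[1], [3, 2]] n \<pi> + occ [[3], [1, 2]] n \<pi>
                       + occ [[3], [2, 1]] n \<pi> + occ [[2, 1]] n \<pi>)"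
    \<comment> \<open>The same two ranges, the values at \<open>x > y\<close> now in decreasing
      order.\<close>
    by (rule mahonianI[where f = "\<lambda>j y x. if x \<le> y then j + x - y else j - x",
          OF _ _ stat3_eq_sum])
      (auto simp: inj_on_def split: if_splits)
qed

end
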